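(* Let $(M,\circ)$ be a monoid with identity element $e_M$ and let $U$ be a disjunctive uninorm. A fuzzy subset $\sigma:M\to[0,1]$ is a $U$-fuzzy submonoid of $(M,\circ)$ if and only if $\sigma(x)=1$ for all $x\in M$.
   Context: A uninorm is a map $U:[0,1]^2\to[0,1]$ that is commutative, associative, non-decreasing in each argument, and has an identity element in $[0,1]$, i.e. some $u\in[0,1]$ with $U(x,u)=x$ for all $x\in[0,1]$. It is disjunctive if $U(1,0)=1$. A map $\sigma:M\to[0,1]$ is a $U$-fuzzy submonoid of $M$ if $U(\sigma(x),\sigma(y))\le\sigma(x\circ y)$ for all $x,y\in M$ and $\sigma(e_M)=1$. *)

theory Defs
  imports Complex_Main "HOL-Algebra.Group"
begin

(* Maps out of [0,1] or out of a monoid are total HOL functions; only their values on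
   {0..1}, respectively on the carrier, are constrained. *)

definition uninorm :: "(real \<Rightarrow> real \<Rightarrow> real) \<Rightarrow> bool" where
  "uninorm U \<longleftrightarrow>
     (\<forall>x\<in>{0..1}. \<forall>y\<in>{0..1}. U x y \<in> {0..1}) \<and>
     (\<forall>x\<in>{0..1}. \<forall>y\<in>{0..1}. U x y = U y x) \<and>
     (\<forall>x\<in>{0..1}. \<forall>y\<in>{0..1}. \<forall>z\<in>{0..1}. U (U x y) z = U x (U y z)) \<and>
     (\<forall>y\<in>{0..1}. mono_on {0..1} (\<lambda>x. U x y)) \<and>
     (\<forall>x\<in>{0..1}. mono_on {0..1} (\<lambda>y. U x y)) \<and>
     (\<exists>u\<in>{0..1}. \<forall>x\<in>{0..1}. U x u = x)"

definition disjunctive :: "(real \<Rightarrow> real \<Rightarrow> real) \<Rightarrow> bool" where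
  "disjunctive U \<longleftrightarrow> U 1 0 = 1"

definition fuzzy_subset :: "('a, 'b) monoid_scheme \<Rightarrow> ('a \<Rightarrow> real) \<Rightarrow> bool" where
  "fuzzy_subset M \<sigma> \<longleftrightarrow> \<sigma> \<in> carrier M \<rightarrow> {0..1}"

definition fuzzy_submonoid ::
    "(real \<Rightarrow> real \<Rightarrow> real) \<Rightarrow> ('a, 'b) monoid_scheme \<Rightarrow> ('a \<Rightarrow> real) \<Rightarrow> bool" where
  "fuzzy_submonoid U M \<sigma> \<longleftrightarrow>
     fuzzy_subset M \<sigma> \<and>
     (\<forall>x\<in>carrier M. \<forall>y\<in>carrier M. U (\<sigma> x) (\<sigma> y) \<le> \<sigma> (x \<otimes>\<^bsub>M\<^esub> y)) \<and>
     \<sigma> \<one>\<^bsub>M\<^esub> = 1"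

end

theory Submission
  imports Defs
begin

text \<open>Disjunctivity makes 1 absorbing: since 0 is the least element of the unit interval,
  monotonicity lifts \<open>U 1 0 = 1\<close> to \<open>U 1 y = 1\<close> for every y
  (\<open>disjunctive_uninorm_one_left\<close>). A fuzzy submonoid takes the value 1 at the
  identity, and multiplying by the identity spreads this value to every element.\<close>

lemma disjunctive_uninorm_one_left:
  assumes "uninorm U" "disjunctive U" "y \<in> {0..1}"
  shows "U 1 y = 1"
proof (rule antisym)
  show "U 1 y \<le> 1"
    using assms(1,3) by (force simp: uninorm_def)
  have "mono_on {0..1} (\<lambda>y. U 1 y)"
    using assms(1) by (simp add: uninorm_def)
  then have "U 1 0 \<le> U 1 y"
    using assms(3) by (auto intro: mono_onD)
  then show "1 \<le> U 1 y"
    using assms(2) by (simp add: disjunctive_def)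
qed

theorem theorem3p1:
  fixes M :: "('a, 'b) monoid_scheme"
    and U :: "real \<Rightarrow> real \<Rightarrow> real"
    and \<sigma> :: "'a \<Rightarrow> real"
  assumes "monoid M"
    and "uninorm U"
    and "disjunctive U"
    and "fuzzy_subset M \<sigma>"
  shows "fuzzy_submonoid U M \<sigma> \<longleftrightarrow> (\<forall>x\<in>carrier M. \<sigma> x = 1)"
proof -
  interpret monoid M by fact
  have range: "\<sigma> x \<in> {0..1}" if "x \<in> carrier M" for x
    using assms(4) that unfolding fuzzy_subset_def by (rule funcset_mem)
  note one_left = disjunctive_uninorm_one_left[OF assms(2,3)]
  show ?thesis
  proof (intro iffI ballI)
    fix x
    assume sub: "fuzzy_submonoid U M \<sigma>" and x: "x \<in> carrier M"
    \<comment> \<open>Pairing x with the identity puts the absorbing value 1 in the first argument,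
      while the product is still x.\<close>
    have "1 = U (\<sigma> \<one>\<^bsub>M\<^esub>) (\<sigma> x)"
      using sub one_left[OF range[OF x]] by (simp add: fuzzy_submonoid_def)
    also have "\<dots> \<le> \<sigma> (\<one>\<^bsub>M\<^esub> \<otimes>\<^bsub>M\<^esub> x)"
      using sub x unfolding fuzzy_submonoid_def by blast
    finally show "\<sigma> x = 1"
      using range[OF x] x by simp
  next
    assume "\<forall>x\<in>carrier M. \<sigma> x = 1"
    then show "fuzzy_submonoid U M \<sigma>"
      \<comment> \<open>For \<sigma> constantly 1 on the carrier, which is closed under products,
        the inequality reduces to \<open>U 1 1 \<le> 1\<close>.\<close>
      using assms(4) one_left[of 1] by (simp add: fuzzy_submonoid_def)
  qed
qed

end
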